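(* Let $\mathsf G=(\mathsf V,\mathsf E,\partial)$ be a countable graph with incoming and outgoing incidence matrices $\mathcal I^+$ and $\mathcal I^-$. Then: (a) The incidence matrices $\mathcal I^+,\mathcal I^-$ are (both) bounded operators from $\ell^2(\mathsf E)$ to $\ell^2(\mathsf V)$ if and only if $\mathsf G$ is uniformly locally finite. (b) The incidence matrices $\mathcal I^+,\mathcal I^-$ are (both) bounded operators from $\ell^\infty(\mathsf E)$ to $\ell^\infty(\mathsf V)$ if and only if $\mathsf G$ is uniformly locally finite. (c) The operators $\mathcal I^+,\mathcal I^-$ are contractive from $\ell^1(\mathsf E)$ to $\ell^\infty(\mathsf V)$.
   Context: An oriented graph is a triple $\mathsf G=(\mathsf V,\mathsf E,\partial)$ with sets $\mathsf V$ (nodes) and $\mathsf E$ (edges) and a map $\partial:\mathsf E\to\mathsf V\times\mathsf V$ giving the start and end node of each edge; it is countable if $\mathsf V$ and $\mathsf E$ are countable. $\Gamma^+(\mathsf v)$ (resp. $\Gamma^-(\mathsf v)$) is the set of edges ending (resp. starting) at $\mathsf v$ and $\deg(\mathsf v)=|\Gamma^+(\mathsf v)|+|\Gamma^-(\mathsf v)|$. The graph is uniformly locally finite if $\sup_{\mathsf v\in\mathsf V}\deg(\mathsf v)<\infty$. The incoming incidence matrix $\mathcal I^+=(\iota^+_{\mathsf v\mathsf e})_{\mathsf v\in\mathsf V,\mathsf e\in\mathsf E}$ has $\iota^+_{\mathsf v\mathsf e}=1$ if $\mathsf e$ ends in $\mathsf v$ and $0$ otherwise; the outgoing incidence matrix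 $\mathcal I^-$ has $\iota^-_{\mathsf v\mathsf e}=1$ if $\mathsf e$ starts in $\mathsf v$ and $0$ otherwise. The matrices act by $(\mathcal I^\pm x)_{\mathsf v}=\sum_{\mathsf e\in\Gamma^\pm(\mathsf v)}x_{\mathsf e}$; such a matrix is a bounded operator from $X$ to $Y$ (sequence spaces) if for all $x\in X$ these series converge absolutely, the result lies in $Y$, and $\|\mathcal I^\pm x\|_Y\le C\|x\|_X$ for some constant $C$; it is contractive if one can take $C=1$. *)

theory Defs
  imports
    "HOL-Analysis.Infinite_Sum"
    "HOL-Library.Extended_Nat"
    "HOL-Library.Extended_Real"
    "Graph_Theory.Digraph"
begin

text \<open>
  An oriented graph is a \<^term>\<open>wf_digraph\<close>: the boundary map sends an edge \<open>e\<close> to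
  \<open>(tail G e, head G e)\<close>.  Loops, parallel edges and infinite degrees are allowed, so the degree is
  an extended natural number (the degrees of the digraph library are \<^const>\<open>card\<close>-based, hence
  \<open>0\<close> at nodes of infinite degree).
\<close>

definition ecard :: "'a set \<Rightarrow> enat" where
  "ecard A = (if finite A then enat (card A) else \<infinity>)"

definition degree :: "('v, 'e) pre_digraph \<Rightarrow> 'v \<Rightarrow> enat" where
  "degree G v = ecard (in_arcs G v) + ecard (out_arcs G v)"

definition uniformly_locally_finite :: "('v, 'e) pre_digraph \<Rightarrow> bool" where
  "uniformly_locally_finite G \<longleftrightarrow> (SUP v\<in>verts G. degree G v) < \<infinity>"

text \<open>
  A sequence indexed by \<open>I\<close> is a total function of which only the values on \<open>I\<close> matter.
  In the supremum norm, \<open>0\<close> is inserted because \<^term>\<open>Sup {} :: real\<close> is unspecified;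
  it has an effect only for \<open>I = {}\<close>.
\<close>

definition lp_space :: "ereal \<Rightarrow> 'i set \<Rightarrow> ('i \<Rightarrow> 'a::real_normed_vector) set" where
  "lp_space p I =
     (if p = \<infinity> then {x. bdd_above ((\<lambda>i. norm (x i)) ` I)}
      else {x. (\<lambda>i. norm (x i) powr real_of_ereal p) summable_on I})"

definition lp_norm :: "ereal \<Rightarrow> 'i set \<Rightarrow> ('i \<Rightarrow> 'a::real_normed_vector) \<Rightarrow> real" where
  "lp_norm p I x =
     (if p = \<infinity> then Sup (insert 0 ((\<lambda>i. norm (x i)) ` I))
      else (\<Sum>\<^sub>\<infinity>i\<in>I. norm (x i) powr real_of_ereal p) powr (1 / real_of_ereal p))"

definition in_incidence :: "('v, 'e) pre_digraph \<Rightarrow> 'v \<Rightarrow> 'e \<Rightarrow> 'a::zero_neq_one" where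
  "in_incidence G v e = (if e \<in> in_arcs G v then 1 else 0)"

definition out_incidence :: "('v, 'e) pre_digraph \<Rightarrow> 'v \<Rightarrow> 'e \<Rightarrow> 'a::zero_neq_one" where
  "out_incidence G v e = (if e \<in> out_arcs G v then 1 else 0)"

definition matrix_apply ::
  "'e set \<Rightarrow> ('v \<Rightarrow> 'e \<Rightarrow> 'a) \<Rightarrow> ('e \<Rightarrow> 'a) \<Rightarrow> 'v \<Rightarrow> 'a::real_normed_field" where
  "matrix_apply E M x v = (\<Sum>\<^sub>\<infinity>e\<in>E. M v e * x e)"

definition bounded_matrix_with ::
  "real \<Rightarrow> 'e set \<Rightarrow> 'v set \<Rightarrow> ereal \<Rightarrow> ereal \<Rightarrow> ('v \<Rightarrow> 'e \<Rightarrow> 'a::real_normed_field) \<Rightarrow> bool" where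
  "bounded_matrix_with C E V p q M \<longleftrightarrow>
     (\<forall>x \<in> lp_space p E.
        (\<forall>v\<in>V. (\<lambda>e. M v e * x e) abs_summable_on E) \<and>
        matrix_apply E M x \<in> lp_space q V \<and>
        lp_norm q V (matrix_apply E M x) \<le> C * lp_norm p E x)"

definition bounded_matrix ::
  "'e set \<Rightarrow> 'v set \<Rightarrow> ereal \<Rightarrow> ereal \<Rightarrow> ('v \<Rightarrow> 'e \<Rightarrow> 'a::real_normed_field) \<Rightarrow> bool" where
  "bounded_matrix E V p q M \<longleftrightarrow> (\<exists>C. bounded_matrix_with C E V p q M)"

definition contractive_matrix ::
  "'e set \<Rightarrow> 'v set \<Rightarrow> ereal \<Rightarrow> ereal \<Rightarrow> ('v \<Rightarrow> 'e \<Rightarrow> 'a::real_normed_field) \<Rightarrow> bool" where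
  "contractive_matrix E V p q M \<longleftrightarrow> bounded_matrix_with 1 E V p q M"

text \<open>The incidence matrices act by summation over the edges ending, resp. starting, at a node.\<close>

lemma matrix_apply_in_incidence:
  "matrix_apply (arcs G) (in_incidence G) x v = (\<Sum>\<^sub>\<infinity>e\<in>in_arcs G v. x e)"
  unfolding matrix_apply_def
  by (rule infsum_cong_neutral) (auto simp: in_incidence_def)

lemma matrix_apply_out_incidence:
  "matrix_apply (arcs G) (out_incidence G) x v = (\<Sum>\<^sub>\<infinity>e\<in>out_arcs G v. x e)"
  unfolding matrix_apply_def
  by (rule infsum_cong_neutral) (auto simp: out_incidence_def)

lemma abs_summable_in_incidence:
  fixes x :: "'e \<Rightarrow> 'a::real_normed_field"
  shows "(\<lambda>e. in_incidence G v e * x e) abs_summable_on arcs G \<longleftrightarrow> x abs_summable_on in_arcs G v"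
  by (rule summable_on_cong_neutral) (auto simp: in_incidence_def)

lemma abs_summable_out_incidence:
  fixes x :: "'e \<Rightarrow> 'a::real_normed_field"
  shows "(\<lambda>e. out_incidence G v e * x e) abs_summable_on arcs G \<longleftrightarrow> x abs_summable_on out_arcs G v"
  by (rule summable_on_cong_neutral) (auto simp: out_incidence_def)

lemma lp_space_1: "x \<in> lp_space 1 I \<longleftrightarrow> x abs_summable_on I"
  by (simp add: lp_space_def)

lemma lp_norm_1: "lp_norm 1 I x = (\<Sum>\<^sub>\<infinity>i\<in>I. norm (x i))"
  by (simp add: lp_norm_def infsum_nonneg)

lemma lp_space_2: "x \<in> lp_space 2 I \<longleftrightarrow> (\<lambda>i. (norm (x i))\<^sup>2) summable_on I"
  by (simp add: lp_space_def powr_numeral)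

lemma lp_norm_2: "lp_norm 2 I x = sqrt (\<Sum>\<^sub>\<infinity>i\<in>I. (norm (x i))\<^sup>2)"
  by (simp add: lp_norm_def powr_numeral powr_half_sqrt infsum_nonneg)

end

theory Submission
  imports Defs "HOL-Analysis.Convex" "HOL-Library.Disjoint_Sets"
begin

text \<open>
  The in-arcs at different nodes are disjoint, and so are the out-arcs, because an edge has one end
  and one start.  Both incidence matrices are therefore of the same kind: for a disjoint family of
  edge sets \<open>A v\<close> they send \<open>x\<close> to \<open>v \<mapsto> (\<Sum>\<^sub>\<infinity>e\<in>A v. x e)\<close>.  Everything is proved for such a
  \<open>membership_matrix\<close>.

  If the matrix is bounded with constant \<open>C\<close> on \<open>\<ell>\<^sup>2\<close> or on \<open>\<ell>\<^sup>\<infinity>\<close>, it is tested on the indicator of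
  a nonempty finite \<open>F \<subseteq> A v\<close>.  The image has the value \<open>card F\<close> at \<open>v\<close>, while the indicator has norm
  at most \<open>sqrt (card F)\<close> in both spaces, whence \<open>card F \<le> C\<^sup>2\<close>
  (\<open>card_le_of_bounded_membership_matrix\<close>).  As this holds for every finite \<open>F\<close>, the sets \<open>A v\<close> are
  finite with a common bound on their size.

  Conversely, let all \<open>A v\<close> have at most \<open>D\<close> elements.  On \<open>\<ell>\<^sup>\<infinity>\<close> the triangle inequality gives the
  bound \<open>D\<close>.  On \<open>\<ell>\<^sup>2\<close> the Cauchy-Schwarz inequality bounds the square of the value at \<open>v\<close> by \<open>D\<close> times
  the square sum of \<open>x\<close> over \<open>A v\<close>; disjointness makes these square sums add up to at most that of
  \<open>x\<close>, which gives the bound \<open>sqrt D\<close>.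

  Contractivity from \<open>\<ell>\<^sup>1\<close> to \<open>\<ell>\<^sup>\<infinity>\<close> is the triangle inequality for a subseries of an absolutely
  convergent series.
\<close>

section \<open>Membership matrices\<close>

definition membership_matrix :: "('v \<Rightarrow> 'e set) \<Rightarrow> 'v \<Rightarrow> 'e \<Rightarrow> 'a::zero_neq_one" where
  "membership_matrix A v e = (if e \<in> A v then 1 else 0)"

lemma in_incidence_eq_membership_matrix: "in_incidence G = membership_matrix (in_arcs G)"
  by (intro ext) (simp add: in_incidence_def membership_matrix_def)

lemma out_incidence_eq_membership_matrix: "out_incidence G = membership_matrix (out_arcs G)"
  by (intro ext) (simp add: out_incidence_def membership_matrix_def)

lemma matrix_apply_membership_matrix:
  assumes "A v \<subseteq> E"
  shows "matrix_apply E (membership_matrix A) x v = (\<Sum>\<^sub>\<infinity>e\<in>A v. x e)"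
  unfolding matrix_apply_def
  by (rule infsum_cong_neutral) (use assms in \<open>auto simp: membership_matrix_def\<close>)

lemma abs_summable_membership_matrix_iff:
  fixes x :: "'e \<Rightarrow> 'a::real_normed_field"
  assumes "A v \<subseteq> E"
  shows "(\<lambda>e. membership_matrix A v e * x e) abs_summable_on E \<longleftrightarrow> x abs_summable_on A v"
  by (rule summable_on_cong_neutral) (use assms in \<open>auto simp: membership_matrix_def\<close>)

section \<open>Pointwise values and norms\<close>

text \<open>
  As a simp rule, this equation turns the exponent \<open>2\<close> into \<open>ereal 2\<close>, so that \<open>lp_space_2\<close> and
  \<open>lp_norm_2\<close> no longer match.
\<close>

declare numeral_eq_ereal [simp del]

lemma lp_space_infinity: "x \<in> lp_space \<infinity> I \<longleftrightarrow> bdd_above ((\<lambda>i. norm (x i)) ` I)"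
  by (simp add: lp_space_def)

lemma norm_le_lp_norm_infinity:
  assumes "x \<in> lp_space \<infinity> I" "i \<in> I"
  shows "norm (x i) \<le> lp_norm \<infinity> I x"
  using assms by (auto simp: lp_norm_def lp_space_infinity intro!: cSup_upper)

lemma lp_norm_infinity_le:
  assumes "0 \<le> B" "\<And>i. i \<in> I \<Longrightarrow> norm (x i) \<le> B"
  shows "lp_norm \<infinity> I x \<le> B"
  using assms by (auto simp: lp_norm_def intro!: cSup_least)

lemma lp_norm_infinity_nonneg:
  assumes "x \<in> lp_space \<infinity> I"
  shows "0 \<le> lp_norm \<infinity> I x"
  using assms by (auto simp: lp_norm_def lp_space_infinity intro!: cSup_upper)

lemma norm_le_lp_norm_2:
  assumes "x \<in> lp_space 2 I" "i \<in> I"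
  shows "norm (x i) \<le> lp_norm 2 I x"
proof -
  have "(\<Sum>\<^sub>\<infinity>j\<in>{i}. (norm (x j))\<^sup>2) \<le> (\<Sum>\<^sub>\<infinity>j\<in>I. (norm (x j))\<^sup>2)"
    by (rule infsum_mono_neutral) (use assms in \<open>auto simp: lp_space_2\<close>)
  then show ?thesis
    by (simp add: lp_norm_2 real_le_rsqrt)
qed

section \<open>Bounded matrices have uniformly finite membership sets\<close>

lemma indicator_in_lp_space:
  assumes "p \<in> {2, \<infinity>}" "finite F" "F \<subseteq> E"
  shows "(\<lambda>e. of_bool (e \<in> F) :: 'a::real_normed_field) \<in> lp_space p E"
proof -
  have "(\<lambda>e. (norm (of_bool (e \<in> F) :: 'a))\<^sup>2) summable_on E"
    by (rule finite_nonzero_values_imp_summable_on, rule finite_subset[OF _ assms(2)])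
      (auto split: if_splits)
  moreover have "bdd_above ((\<lambda>e. norm (of_bool (e \<in> F) :: 'a)) ` E)"
    by (rule bdd_aboveI[of _ 1]) auto
  ultimately show ?thesis
    using assms(1) by (auto simp: lp_space_2 lp_space_infinity)
qed

text \<open>
  For \<open>p = 2\<close> this is an equality; for \<open>p = \<infinity>\<close> the norm is only \<open>1\<close>, and the cruder common bound lets
  one argument serve both exponents.
\<close>

lemma lp_norm_indicator_le:
  assumes "p \<in> {2, \<infinity>}" "finite F" "F \<noteq> {}" "F \<subseteq> E"
  shows "lp_norm p E (\<lambda>e. of_bool (e \<in> F) :: 'a::real_normed_field) \<le> sqrt (card F)"
proof -
  have "(\<Sum>\<^sub>\<infinity>e\<in>E. (norm (of_bool (e \<in> F) :: 'a))\<^sup>2) = (\<Sum>\<^sub>\<infinity>e\<in>F. 1)"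
    by (rule infsum_cong_neutral) (use assms in auto)
  also have "\<dots> = card F"
    using assms by simp
  finally have "lp_norm 2 E (\<lambda>e. of_bool (e \<in> F) :: 'a) \<le> sqrt (card F)"
    by (simp add: lp_norm_2)
  moreover have "1 \<le> card F"
    using assms by (simp add: Suc_le_eq card_gt_0_iff)
  then have "lp_norm \<infinity> E (\<lambda>e. of_bool (e \<in> F) :: 'a) \<le> sqrt (card F)"
    by (intro lp_norm_infinity_le) auto
  ultimately show ?thesis
    using assms(1) by auto
qed

text \<open>
  The value at \<open>v\<close> of the image of the indicator of \<open>F\<close> is \<open>card F\<close>, which grows faster than the norm
  \<open>sqrt (card F)\<close> of the indicator.  The test set is a finite subset because \<open>A v\<close> may still be infinite,
  and then its own indicator is not in \<open>\<ell>\<^sup>2\<close>.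
\<close>

lemma card_le_of_bounded_membership_matrix:
  fixes C :: real
  assumes bounded:
      "bounded_matrix_with C E V p p (membership_matrix A :: 'v \<Rightarrow> 'e \<Rightarrow> 'a::real_normed_field)"
    and p: "p \<in> {2, \<infinity>}" and v: "v \<in> V" "A v \<subseteq> E"
    and F: "finite F" "F \<subseteq> A v"
  shows "card F \<le> C\<^sup>2"
proof (cases "F = {}")
  case False
  let ?x = "\<lambda>e. of_bool (e \<in> F) :: 'a"
  let ?y = "matrix_apply E (membership_matrix A) ?x"
  have x: "?x \<in> lp_space p E"
    using p F v by (intro indicator_in_lp_space) auto
  have "?y v = (\<Sum>\<^sub>\<infinity>e\<in>A v. ?x e)"
    using v by (simp add: matrix_apply_membership_matrix)
  also have "\<dots> = (\<Sum>\<^sub>\<infinity>e\<in>F. 1)"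
    by (rule infsum_cong_neutral) (use F in auto)
  finally have "real (card F) = norm (?y v)"
    using F by simp
  also have "\<dots> \<le> lp_norm p V ?y"
    using bounded x p v norm_le_lp_norm_2[of ?y V v] norm_le_lp_norm_infinity[of ?y V v]
    by (auto simp: bounded_matrix_with_def)
  also have "\<dots> \<le> C * lp_norm p E ?x"
    using bounded x by (simp add: bounded_matrix_with_def)
  \<comment> \<open>\<open>C\<close> could be negative, and monotonicity of the product asks for a nonnegative factor\<close>
  also have "\<dots> \<le> \<bar>C\<bar> * sqrt (card F)"
  proof (rule mult_mono)
    show "0 \<le> lp_norm p E ?x"
      using p x by (auto simp: lp_norm_infinity_nonneg lp_norm_2 infsum_nonneg)
    show "lp_norm p E ?x \<le> sqrt (card F)"
      using p F v False by (intro lp_norm_indicator_le) auto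
  qed auto
  finally have "sqrt (card F) * sqrt (card F) \<le> \<bar>C\<bar> * sqrt (card F)"
    by simp
  moreover have "0 < sqrt (card F)"
    using F False by (simp add: card_gt_0_iff)
  ultimately have "sqrt (card F) \<le> \<bar>C\<bar>"
    by (simp only: mult_le_cancel_right_pos)
  then show ?thesis
    by (metis real_sqrt_abs real_sqrt_le_iff)
qed simp

section \<open>Uniformly finite membership sets give bounded matrices\<close>

lemma norm_sum_power2_le:
  fixes x :: "'e \<Rightarrow> 'a::real_normed_vector"
  shows "(norm (\<Sum>e\<in>A. x e))\<^sup>2 \<le> card A * (\<Sum>e\<in>A. (norm (x e))\<^sup>2)"
proof -
  have "(norm (\<Sum>e\<in>A. x e))\<^sup>2 \<le> (\<Sum>e\<in>A. norm (x e))\<^sup>2"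
    by (intro power_mono norm_sum) auto
  also have "\<dots> \<le> card A * (\<Sum>e\<in>A. (norm (x e))\<^sup>2)"
    using sum_squared_le_sum_of_squares[of "\<lambda>e. norm (x e)" A] by (simp add: mult.commute)
  finally show ?thesis .
qed

text \<open>
  Cauchy-Schwarz at each node costs a factor \<open>D\<close>; by disjointness every edge contributes to at most
  one node, so summing over the nodes costs nothing more.
\<close>

lemma bounded_membership_matrix_2:
  assumes "\<And>v. v \<in> V \<Longrightarrow> A v \<subseteq> E" "disjoint_family_on A V"
    and "\<And>v. v \<in> V \<Longrightarrow> finite (A v) \<and> card (A v) \<le> D"
  shows "bounded_matrix_with (sqrt (real D)) E V 2 2
    (membership_matrix A :: 'v \<Rightarrow> 'e \<Rightarrow> 'a::real_normed_field)"
  unfolding bounded_matrix_with_def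
proof (intro ballI conjI)
  fix x :: "'e \<Rightarrow> 'a"
  assume x: "x \<in> lp_space 2 E"
  let ?y = "matrix_apply E (membership_matrix A) x"
  show "(\<lambda>e. membership_matrix A v e * x e) abs_summable_on E" if "v \<in> V" for v
    using that assms by (simp add: abs_summable_membership_matrix_iff)
  have y: "?y v = (\<Sum>e\<in>A v. x e)" if "v \<in> V" for v
    using that assms by (simp add: matrix_apply_membership_matrix)
  \<comment> \<open>bounds on finite partial sums give both summability of the image and the norm estimate\<close>
  have partial: "(\<Sum>v\<in>W. (norm (?y v))\<^sup>2) \<le> D * (\<Sum>\<^sub>\<infinity>e\<in>E. (norm (x e))\<^sup>2)"
    if W: "finite W" "W \<subseteq> V" for W
  proof -
    have "(\<Sum>v\<in>W. (norm (?y v))\<^sup>2) \<le> (\<Sum>v\<in>W. D * (\<Sum>e\<in>A v. (norm (x e))\<^sup>2))"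
    proof (rule sum_mono)
      fix v assume "v \<in> W"
      then have v: "v \<in> V" using W by auto
      have "(norm (?y v))\<^sup>2 \<le> card (A v) * (\<Sum>e\<in>A v. (norm (x e))\<^sup>2)"
        using norm_sum_power2_le[of x "A v"] by (simp add: y v)
      also have "\<dots> \<le> D * (\<Sum>e\<in>A v. (norm (x e))\<^sup>2)"
        using assms(3)[OF v] by (intro mult_right_mono sum_nonneg) auto
      finally show "(norm (?y v))\<^sup>2 \<le> D * (\<Sum>e\<in>A v. (norm (x e))\<^sup>2)" .
    qed
    also have "\<dots> = D * (\<Sum>e\<in>(\<Union>v\<in>W. A v). (norm (x e))\<^sup>2)"
      using W assms(3) disjoint_family_on_mono[OF W(2) assms(2)]
      by (subst sum.UNION_disjoint) (auto simp: disjoint_family_on_def sum_distrib_left)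
    also have "\<dots> \<le> D * (\<Sum>\<^sub>\<infinity>e\<in>E. (norm (x e))\<^sup>2)"
      using x W assms(1,3) by (intro mult_left_mono finite_sum_le_infsum) (auto simp: lp_space_2)
    finally show ?thesis .
  qed
  have summable: "(\<lambda>v. (norm (?y v))\<^sup>2) summable_on V"
    by (rule nonneg_bdd_above_summable_on)
      (auto intro!: bdd_aboveI[of _ "D * (\<Sum>\<^sub>\<infinity>e\<in>E. (norm (x e))\<^sup>2)"] partial)
  then show "?y \<in> lp_space 2 V"
    by (simp add: lp_space_2)
  have "(\<Sum>\<^sub>\<infinity>v\<in>V. (norm (?y v))\<^sup>2) \<le> D * (\<Sum>\<^sub>\<infinity>e\<in>E. (norm (x e))\<^sup>2)"
    using summable partial by (rule infsum_le_finite_sums)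
  then show "lp_norm 2 V ?y \<le> sqrt D * lp_norm 2 E x"
    by (simp add: lp_norm_2 flip: real_sqrt_mult)
qed

lemma bounded_membership_matrix_infinity:
  assumes "\<And>v. v \<in> V \<Longrightarrow> A v \<subseteq> E"
    and "\<And>v. v \<in> V \<Longrightarrow> finite (A v) \<and> card (A v) \<le> D"
  shows "bounded_matrix_with (real D) E V \<infinity> \<infinity>
    (membership_matrix A :: 'v \<Rightarrow> 'e \<Rightarrow> 'a::real_normed_field)"
  unfolding bounded_matrix_with_def
proof (intro ballI conjI)
  fix x :: "'e \<Rightarrow> 'a"
  assume x: "x \<in> lp_space \<infinity> E"
  let ?y = "matrix_apply E (membership_matrix A) x"
  show "(\<lambda>e. membership_matrix A v e * x e) abs_summable_on E" if "v \<in> V" for v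
    using that assms by (simp add: abs_summable_membership_matrix_iff)
  have le: "norm (?y v) \<le> D * lp_norm \<infinity> E x" if v: "v \<in> V" for v
  proof -
    have "norm (?y v) \<le> (\<Sum>e\<in>A v. norm (x e))"
      using v assms by (simp add: matrix_apply_membership_matrix norm_sum)
    also have "\<dots> \<le> card (A v) * lp_norm \<infinity> E x"
      by (intro sum_bounded_above norm_le_lp_norm_infinity x) (use assms v in auto)
    also have "\<dots> \<le> D * lp_norm \<infinity> E x"
      using assms(2)[OF v] x by (intro mult_right_mono lp_norm_infinity_nonneg) auto
    finally show ?thesis .
  qed
  then show "?y \<in> lp_space \<infinity> V"
    by (auto simp: lp_space_infinity intro!: bdd_aboveI)
  show "lp_norm \<infinity> V ?y \<le> D * lp_norm \<infinity> E x"
    by (intro lp_norm_infinity_le le mult_nonneg_nonneg lp_norm_infinity_nonneg x) auto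
qed

lemma bounded_membership_matrix_iff:
  assumes "\<And>v. v \<in> V \<Longrightarrow> A v \<subseteq> E" "disjoint_family_on A V" "p \<in> {2, \<infinity>}"
  shows "bounded_matrix E V p p (membership_matrix A :: 'v \<Rightarrow> 'e \<Rightarrow> 'a::real_normed_field)
    \<longleftrightarrow> (\<exists>D. \<forall>v\<in>V. finite (A v) \<and> card (A v) \<le> D)"
proof
  assume "bounded_matrix E V p p (membership_matrix A :: 'v \<Rightarrow> 'e \<Rightarrow> 'a)"
  then obtain C where
    C: "bounded_matrix_with C E V p p (membership_matrix A :: 'v \<Rightarrow> 'e \<Rightarrow> 'a)"
    by (auto simp: bounded_matrix_def)
  have "finite (A v) \<and> card (A v) \<le> nat \<lfloor>C\<^sup>2\<rfloor>" if "v \<in> V" for v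
  proof (rule finite_if_finite_subsets_card_bdd)
    fix F assume "F \<subseteq> A v" "finite F"
    then have "card F \<le> C\<^sup>2"
      using card_le_of_bounded_membership_matrix[OF C] assms that by blast
    then show "card F \<le> nat \<lfloor>C\<^sup>2\<rfloor>"
      by (simp add: le_nat_floor)
  qed
  then show "\<exists>D. \<forall>v\<in>V. finite (A v) \<and> card (A v) \<le> D"
    by blast
next
  assume "\<exists>D. \<forall>v\<in>V. finite (A v) \<and> card (A v) \<le> D"
  then obtain D where "\<And>v. v \<in> V \<Longrightarrow> finite (A v) \<and> card (A v) \<le> D"
    by blast
  then show "bounded_matrix E V p p (membership_matrix A :: 'v \<Rightarrow> 'e \<Rightarrow> 'a)"
    using assms bounded_membership_matrix_2[of V A E D] bounded_membership_matrix_infinity[of V A E D]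
    unfolding bounded_matrix_def by blast
qed

section \<open>Contractivity on absolutely summable sequences\<close>

text \<open>
  The sets \<open>A v\<close> may be infinite here; completeness of \<open>'a\<close> makes the absolutely convergent series over
  \<open>A v\<close> converge.
\<close>

lemma contractive_membership_matrix_1_infinity:
  assumes "\<And>v. v \<in> V \<Longrightarrow> A v \<subseteq> E"
  shows "contractive_matrix E V 1 \<infinity>
    (membership_matrix A :: 'v \<Rightarrow> 'e \<Rightarrow> 'a::{real_normed_field, banach})"
  unfolding contractive_matrix_def bounded_matrix_with_def mult_1
proof (intro ballI conjI)
  fix x :: "'e \<Rightarrow> 'a"
  assume "x \<in> lp_space 1 E"
  then have x: "x abs_summable_on E"
    by (simp add: lp_space_1)
  have xv: "x abs_summable_on A v" if "v \<in> V" for v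
    using summable_on_subset_banach[OF x] assms that by blast
  let ?y = "matrix_apply E (membership_matrix A) x"
  show "(\<lambda>e. membership_matrix A v e * x e) abs_summable_on E" if "v \<in> V" for v
    using that assms by (simp add: abs_summable_membership_matrix_iff xv)
  have le: "norm (?y v) \<le> lp_norm 1 E x" if v: "v \<in> V" for v
  proof -
    have "norm (?y v) \<le> (\<Sum>\<^sub>\<infinity>e\<in>A v. norm (x e))"
      using v assms xv by (simp add: matrix_apply_membership_matrix norm_infsum_bound)
    also have "\<dots> \<le> (\<Sum>\<^sub>\<infinity>e\<in>E. norm (x e))"
      using v assms xv x by (intro infsum_mono_neutral) auto
    finally show ?thesis
      by (simp add: lp_norm_1)
  qed
  then show "?y \<in> lp_space \<infinity> V"
    by (auto simp: lp_space_infinity intro!: bdd_aboveI)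
  show "lp_norm \<infinity> V ?y \<le> lp_norm 1 E x"
    by (intro lp_norm_infinity_le le) (simp add: lp_norm_1 infsum_nonneg)
qed

section \<open>Uniform local finiteness\<close>

lemma ecard_le_enat_iff: "ecard A \<le> enat D \<longleftrightarrow> finite A \<and> card A \<le> D"
  by (simp add: ecard_def)

lemma SUP_enat_less_infinity_iff:
  "(SUP v\<in>V. f v) < (\<infinity>::enat) \<longleftrightarrow> (\<exists>D. \<forall>v\<in>V. f v \<le> enat D)"
proof
  assume "(SUP v\<in>V. f v) < \<infinity>"
  then obtain D where "(SUP v\<in>V. f v) = enat D"
    by (auto simp: less_infinityE)
  then show "\<exists>D. \<forall>v\<in>V. f v \<le> enat D"
    by (metis SUP_upper)
next
  assume "\<exists>D. \<forall>v\<in>V. f v \<le> enat D"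
  then obtain D where "(SUP v\<in>V. f v) \<le> enat D"
    by (metis SUP_least)
  then show "(SUP v\<in>V. f v) < \<infinity>"
    by (rule order.strict_trans1) simp
qed

text \<open>
  The degree is the sum of the two extended cardinalities, so it is uniformly bounded iff each
  of them is.  Splitting the condition matches the two incidence matrices one by one.
\<close>

lemma uniformly_locally_finite_iff:
  "uniformly_locally_finite G \<longleftrightarrow>
    (\<exists>D. \<forall>v\<in>verts G. finite (in_arcs G v) \<and> card (in_arcs G v) \<le> D)
    \<and> (\<exists>D. \<forall>v\<in>verts G. finite (out_arcs G v) \<and> card (out_arcs G v) \<le> D)"
  (is "_ \<longleftrightarrow> ?in \<and> ?out")
proof
  assume "uniformly_locally_finite G"
  then obtain D where D: "\<And>v. v \<in> verts G \<Longrightarrow> degree G v \<le> enat D"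
    unfolding uniformly_locally_finite_def SUP_enat_less_infinity_iff by blast
  have "ecard (in_arcs G v) \<le> degree G v" "ecard (out_arcs G v) \<le> degree G v" for v
    by (simp_all add: degree_def)
  with D have "ecard (in_arcs G v) \<le> enat D" "ecard (out_arcs G v) \<le> enat D"
    if "v \<in> verts G" for v
    using that order_trans by blast+
  then show "?in \<and> ?out"
    unfolding ecard_le_enat_iff by blast
next
  assume "?in \<and> ?out"
  then obtain D D' where
    "\<And>v. v \<in> verts G \<Longrightarrow> ecard (in_arcs G v) \<le> enat D"
    "\<And>v. v \<in> verts G \<Longrightarrow> ecard (out_arcs G v) \<le> enat D'"
    unfolding ecard_le_enat_iff by blast
  then have "degree G v \<le> enat (D + D')" if "v \<in> verts G" for v
    using that unfolding degree_def plus_enat_simps(1)[symmetric] by (intro add_mono)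
  then show "uniformly_locally_finite G"
    unfolding uniformly_locally_finite_def SUP_enat_less_infinity_iff by blast
qed

theorem proposition6:
  fixes G :: "('v, 'e) pre_digraph"
  assumes "wf_digraph G"
    and "countable (verts G)"
    and "countable (arcs G)"
  shows "(bounded_matrix (arcs G) (verts G) 2 2
            (in_incidence G :: 'v \<Rightarrow> 'e \<Rightarrow> 'a::{real_normed_field, banach})
          \<and> bounded_matrix (arcs G) (verts G) 2 2 (out_incidence G :: 'v \<Rightarrow> 'e \<Rightarrow> 'a)
          \<longleftrightarrow> uniformly_locally_finite G)
      \<and> (bounded_matrix (arcs G) (verts G) \<infinity> \<infinity> (in_incidence G :: 'v \<Rightarrow> 'e \<Rightarrow> 'a)
          \<and> bounded_matrix (arcs G) (verts G) \<infinity> \<infinity> (out_incidence G :: 'v \<Rightarrow> 'e \<Rightarrow> 'a)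
          \<longleftrightarrow> uniformly_locally_finite G)
      \<and> contractive_matrix (arcs G) (verts G) 1 \<infinity> (in_incidence G :: 'v \<Rightarrow> 'e \<Rightarrow> 'a)
      \<and> contractive_matrix (arcs G) (verts G) 1 \<infinity> (out_incidence G :: 'v \<Rightarrow> 'e \<Rightarrow> 'a)"
proof -
  have sub: "in_arcs G v \<subseteq> arcs G" "out_arcs G v \<subseteq> arcs G" for v
    by auto
  have disj: "disjoint_family_on (in_arcs G) (verts G)" "disjoint_family_on (out_arcs G) (verts G)"
    by (auto simp: disjoint_family_on_def)
  have bounded_iff:
    "bounded_matrix (arcs G) (verts G) p p (in_incidence G :: 'v \<Rightarrow> 'e \<Rightarrow> 'a)
      \<and> bounded_matrix (arcs G) (verts G) p p (out_incidence G :: 'v \<Rightarrow> 'e \<Rightarrow> 'a)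
      \<longleftrightarrow> uniformly_locally_finite G" if "p \<in> {2, \<infinity>}" for p
    unfolding in_incidence_eq_membership_matrix out_incidence_eq_membership_matrix
      uniformly_locally_finite_iff
    by (simp only: bounded_membership_matrix_iff[OF sub(1) disj(1) that]
        bounded_membership_matrix_iff[OF sub(2) disj(2) that])
  show ?thesis
    using bounded_iff[of 2] bounded_iff[of \<infinity>] sub
    by (simp add: in_incidence_eq_membership_matrix out_incidence_eq_membership_matrix
        contractive_membership_matrix_1_infinity)
qed

end
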